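(* Let $a\geq 1$ and $k\geq 2$ be integers and let $b=ak+1$. Let $T$ be a tree with $k$ interior vertices and $b$ leaves. Then $$\lambda_1(T)\ \leq\ \frac{k+2a+1-\sqrt{(k-1)^2+4k-4}}{2}.$$ Equality holds if and only if $T$ is (isomorphic to) the star-like path tree $SLP(a+1,a;0;k-1,0)$.
   Context: For a finite tree $T=(V,E)$ with at least three vertices, the boundary $B$ is the set of leaves (degree-one vertices) and the interior is $\Omega=V\setminus B$; interior vertices are the non-leaf vertices. The first Dirichlet eigenvalue $\lambda_1(T)$ is the smallest $\lambda$ for which there is a nonzero $f:V\to\mathbb{R}$ with $f=0$ on $B$ and $\sum_{y\sim x}(f(x)-f(y))=\lambda f(x)$ for all $x\in\Omega$. Star-like path tree: for integers $q\geq1$ and $p,c,d,e\geq 0$, $SLP(p,q;c;d,e)$ is the tree obtained as follows. Take a path $u_0\sim u_1\sim\cdots\sim u_c$ of length $c$ (a single vertex $u_0=u_c$ if $c=0$). Attach $d$ new vertices $u_{0,1},\dots,u_{0,d}$ to $u_0$ and $e$ new vertices $u_{c,1},\dots,u_{c,e}$ to $u_c$. Then attach $p$ leaves to each vertex of the set $\{u_0,u_c\}$, and attach $q$ leaves to each of the vertices $u_{0,i}$ ($1\le i\le d$), $u_{c,j}$ ($1\le j\le e$), and $u_1,\dots,u_{c-1}$. In particular, $SLP(a+1,a;0;k-1,0)$ consists of a vertex $u_0$ with $a+1$ leaves attached, adjacent to $k-1$ further vertices each having $a$ leaves attached. *)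

theory Defs
  imports Complex_Main "Graph_Theory.Graph_Theory"
begin

text \<open>
  Finite simple graphs are the finite, symmetric, loop-free pair digraphs (\<open>pair_graph\<close>)
  of the library: an undirected edge between x and y is the pair of arcs (x, y) and (y, x).
  The library predicate \<open>tree\<close> cannot be used for them, since
  \<open>pre_digraph.cycle\<close> counts the closed walk x, y, x along one edge as a cycle. Without loops and
  parallel arcs, the cycles of the undirected graph are those of length at least 3.
\<close>
definition simple_tree :: "'a pair_pre_digraph \<Rightarrow> bool" where
  "simple_tree T \<longleftrightarrow>
     pair_graph T \<and>
     Digraph_Component.connected (with_proj T) \<and>
     \<not> (\<exists>c. pre_digraph.cycle (with_proj T) c \<and> length c \<ge> 3)"

definition boundary_verts :: "'a pair_pre_digraph \<Rightarrow> 'a set" where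
  "boundary_verts T = {x \<in> pverts T. out_degree (with_proj T) x = 1}"

definition interior_verts :: "'a pair_pre_digraph \<Rightarrow> 'a set" where
  "interior_verts T = pverts T - boundary_verts T"

text \<open>
  Functions on the vertex set are total functions on the vertex type; their values off
  \<open>pverts T\<close> play no role, so being nonzero has to be witnessed in \<open>pverts T\<close>.
\<close>
definition dirichlet_eigenvalue :: "'a pair_pre_digraph \<Rightarrow> real \<Rightarrow> bool" where
  "dirichlet_eigenvalue T l \<longleftrightarrow>
     (\<exists>f :: 'a \<Rightarrow> real.
        (\<exists>x \<in> pverts T. f x \<noteq> 0) \<and>
        (\<forall>x \<in> boundary_verts T. f x = 0) \<and>
        (\<forall>x \<in> interior_verts T. (\<Sum>y \<in> {y. (x, y) \<in> parcs T}. f x - f y) = l * f x))"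

definition first_dirichlet_eigenvalue :: "'a pair_pre_digraph \<Rightarrow> real" where
  "first_dirichlet_eigenvalue T = (LEAST l. dirichlet_eigenvalue T l)"

text \<open>
  Vertices of star-like path trees: \<open>Spine i\<close> is $u_i$, \<open>Lft i\<close> is $u_{0,i}$, \<open>Rgt j\<close> is $u_{c,j}$,
  and \<open>Pendant v i\<close> is the i-th leaf attached to v.
\<close>
datatype slp_vertex = Spine nat | Lft nat | Rgt nat | Pendant slp_vertex nat

definition slp_ends :: "nat \<Rightarrow> slp_vertex set" where
  "slp_ends c = {Spine 0, Spine c}"

definition slp_others :: "nat \<Rightarrow> nat \<Rightarrow> nat \<Rightarrow> slp_vertex set" where
  "slp_others c d e = Lft ` {1..d} \<union> Rgt ` {1..e} \<union> Spine ` {0<..<c}"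

definition slp_arcs :: "nat \<Rightarrow> nat \<Rightarrow> nat \<Rightarrow> nat \<Rightarrow> nat \<Rightarrow> slp_vertex rel" where
  "slp_arcs p q c d e =
     {(Spine i, Spine (Suc i)) | i. i < c} \<union>
     {(Spine 0, Lft i) | i. i \<in> {1..d}} \<union>
     {(Spine c, Rgt j) | j. j \<in> {1..e}} \<union>
     {(v, Pendant v i) | v i. v \<in> slp_ends c \<and> i \<in> {1..p}} \<union>
     {(v, Pendant v i) | v i. v \<in> slp_others c d e \<and> i \<in> {1..q}}"

text \<open>
  \<open>SLP p q c d e\<close> is $SLP(p,q;c;d,e)$. For c = 0 the set \<open>slp_ends c\<close> is a singleton, so
  the single spine vertex receives p leaves, not 2p.
\<close>
definition SLP :: "nat \<Rightarrow> nat \<Rightarrow> nat \<Rightarrow> nat \<Rightarrow> nat \<Rightarrow> slp_vertex pair_pre_digraph" where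
  "SLP p q c d e =
     \<lparr> pverts = slp_ends c \<union> slp_others c d e
         \<union> {Pendant v i | v i. v \<in> slp_ends c \<and> i \<in> {1..p}}
         \<union> {Pendant v i | v i. v \<in> slp_others c d e \<and> i \<in> {1..q}},
       parcs = slp_arcs p q c d e \<union> (slp_arcs p q c d e)\<inverse> \<rparr>"

end

theory Submission
  imports Defs "HOL-Analysis.Analysis"
begin

text \<open>
  The first Dirichlet eigenvalue is the minimum of the Rayleigh quotient over functions vanishing
  on the leaves. Let m be the root of $m^2 - (k+1) m + 1$ in $(0, 1)$, so that the bound is $a + m$.
  If no interior vertex has more than a leaves, the constant function on the interior shows that
  the eigenvalue is at most a. Otherwise some v has at least $a + 1$ leaves, and the function that
  is $1 - m$ at v and 1 on the other interior vertices has Rayleigh quotient at most $a + m$, with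
  equality only if v has exactly $a + 1$ leaves and is adjacent to all other interior vertices.
  If the eigenvalue is $a + m$, this function is moreover an eigenfunction, which forces a leaves at
  every other interior vertex. Conversely, on the star-like tree the eigenvalue equations reduce to
  one scalar equation without solutions below $a + m$.
\<close>

section \<open>Least eigenvalue of a symmetric form\<close>

text \<open>First variation: adding t to f at the single coordinate z changes the form minus l times
  the squared norm by 2 t r + t^2 c, where r is the residual of the eigenvalue equation at z. This
  is nonnegative for every t, so r = 0.\<close>

lemma rayleigh_minimizer_eigenvector:
  fixes A :: "'a \<Rightarrow> 'a \<Rightarrow> real"
  assumes fin: "finite W"
    and sym: "\<And>x y. x \<in> W \<Longrightarrow> y \<in> W \<Longrightarrow> A x y = A y x"
    and min: "\<And>g. l * (\<Sum>x\<in>W. (g x)\<^sup>2) \<le> (\<Sum>x\<in>W. g x * (\<Sum>y\<in>W. A x y * g y))"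
    and eq: "(\<Sum>x\<in>W. f x * (\<Sum>y\<in>W. A x y * f y)) = l * (\<Sum>x\<in>W. (f x)\<^sup>2)"
    and z: "z \<in> W"
  shows "(\<Sum>y\<in>W. A z y * f y) = l * f z"
proof -
  define r where "r = (\<Sum>y\<in>W. A z y * f y) - l * f z"
  define c where "c = A z z - l"
  have perturb: "0 \<le> 2 * t * r + t\<^sup>2 * c" for t
  proof -
    define e where "e = (\<lambda>x. if x = z then t else 0)"
    \<comment> \<open>By symmetry the column of \<open>A\<close> at z acts like its row, so the two
      linear terms in t coincide.\<close>
    have col: "(\<Sum>x\<in>W. f x * A x z) = (\<Sum>y\<in>W. A z y * f y)"
      using sym z by (intro sum.cong) (auto simp: mult.commute)
    have row: "(\<Sum>y\<in>W. A x y * (f y + e y)) = (\<Sum>y\<in>W. A x y * f y) + A x z * t" for x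
    proof -
      have "(\<Sum>y\<in>W. A x y * e y) = (\<Sum>y\<in>W. if y = z then A x z * t else 0)"
        by (intro sum.cong) (auto simp: e_def)
      then show ?thesis
        using fin z by (simp add: distrib_left sum.distrib)
    qed
    have "(\<Sum>x\<in>W. (f x + e x) * (\<Sum>y\<in>W. A x y * (f y + e y)))
        = (\<Sum>x\<in>W. f x * (\<Sum>y\<in>W. A x y * f y) + t * (f x * A x z)
            + (if x = z then t * (\<Sum>y\<in>W. A z y * f y) + t * t * A z z else 0))"
      unfolding row by (intro sum.cong) (auto simp: e_def algebra_simps)
    also have "\<dots> = l * (\<Sum>x\<in>W. (f x)\<^sup>2) + 2 * t * (\<Sum>y\<in>W. A z y * f y) + t\<^sup>2 * A z z"
      using fin z
      by (simp add: sum.distrib eq col sum_distrib_left[symmetric] power2_eq_square)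
    finally have form: "(\<Sum>x\<in>W. (f x + e x) * (\<Sum>y\<in>W. A x y * (f y + e y)))
        = l * (\<Sum>x\<in>W. (f x)\<^sup>2) + 2 * t * (\<Sum>y\<in>W. A z y * f y) + t\<^sup>2 * A z z" .
    have "(\<Sum>x\<in>W. (f x + e x)\<^sup>2)
        = (\<Sum>x\<in>W. (f x)\<^sup>2 + (if x = z then 2 * t * f z + t\<^sup>2 else 0))"
      by (intro sum.cong) (auto simp: e_def power2_eq_square algebra_simps)
    also have "\<dots> = (\<Sum>x\<in>W. (f x)\<^sup>2) + 2 * t * f z + t\<^sup>2"
      using fin z by (simp add: sum.distrib)
    finally show ?thesis
      using min[of "\<lambda>x. f x + e x"] form by (simp add: r_def c_def algebra_simps)
  qed
  have "r = 0"
  proof (rule ccontr)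
    assume "r \<noteq> 0"
    \<comment> \<open>At t = - r / d the perturbation equals (r / d)^2 (c - 2 d), which is negative
      as soon as 2 d exceeds c.\<close>
    define d where "d = 1 + \<bar>c\<bar>"
    have d: "d > 0" "c < 2 * d" by (auto simp: d_def)
    have "2 * (- r / d) * r + (- r / d)\<^sup>2 * c = (r / d)\<^sup>2 * (c - 2 * d)"
      using d by (simp add: field_simps power2_eq_square)
    moreover have "(r / d)\<^sup>2 * (c - 2 * d) < 0"
      using d \<open>r \<noteq> 0\<close> by (simp add: mult_pos_neg)
    ultimately show False using perturb[of "- r / d"] by simp
  qed
  then show ?thesis by (simp add: r_def)
qed

text \<open>The quadratic form attains its minimum on the unit sphere of functions supported on
  \<open>W\<close>; by homogeneity this minimum bounds the Rayleigh quotient everywhere, and the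
  first variation turns a minimizer into an eigenvector.\<close>

lemma least_eigenvalue_exists:
  fixes A :: "'a \<Rightarrow> 'a \<Rightarrow> real"
  assumes fin: "finite W" and "W \<noteq> {}"
    and sym: "\<And>x y. x \<in> W \<Longrightarrow> y \<in> W \<Longrightarrow> A x y = A y x"
  obtains l f where "\<exists>x\<in>W. f x \<noteq> 0" and "\<And>x. x \<notin> W \<Longrightarrow> f x = 0"
    and "\<And>x. x \<in> W \<Longrightarrow> (\<Sum>y\<in>W. A x y * f y) = l * f x"
    and "\<And>g. l * (\<Sum>x\<in>W. (g x)\<^sup>2) \<le> (\<Sum>x\<in>W. g x * (\<Sum>y\<in>W. A x y * g y))"
proof -
  define Q where "Q = (\<lambda>g :: 'a \<Rightarrow> real. \<Sum>x\<in>W. g x * (\<Sum>y\<in>W. A x y * g y))"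
  \<comment> \<open>Pinning the coordinates off \<open>W\<close> to 0 makes \<open>P\<close> a
    product of compact sets, hence compact by Tychonoff even if the type is infinite. It contains
    the whole unit sphere of functions supported on \<open>W\<close>.\<close>
  define P :: "('a \<Rightarrow> real) set" where "P = (\<Pi>\<^sub>E x\<in>UNIV. if x \<in> W then {-1..1} else {0})"
  define S :: "('a \<Rightarrow> real) set" where "S = {g. (\<Sum>x\<in>W. (g x)\<^sup>2) = 1}"
  have "compactin (product_topology (\<lambda>_. euclidean) UNIV) P"
    unfolding P_def compactin_PiE by auto
  then have "compact P"
    by (simp add: euclidean_product_topology)
  moreover have "closed S"
  proof -
    have "continuous_on UNIV (\<lambda>g :: 'a \<Rightarrow> real. \<Sum>x\<in>W. (g x)\<^sup>2)"
      by (intro continuous_intros continuous_on_product_coordinates)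
    then have "closed ((\<lambda>g :: 'a \<Rightarrow> real. \<Sum>x\<in>W. (g x)\<^sup>2) -` {1})"
      by (intro closed_vimage) auto
    then show ?thesis by (simp add: S_def vimage_def)
  qed
  ultimately have compact: "compact (P \<inter> S)" by (rule compact_Int_closed)
  \<comment> \<open>Cutting off outside \<open>W\<close> and dividing by the norm lands in the
    compact set, since no coordinate exceeds the norm.\<close>
  have normalized: "(\<lambda>x. if x \<in> W then g x / sqrt (\<Sum>x\<in>W. (g x)\<^sup>2) else 0) \<in> P \<inter> S"
    if pos: "(\<Sum>x\<in>W. (g x)\<^sup>2) > 0" for g :: "'a \<Rightarrow> real"
  proof -
    define s where "s = (\<Sum>x\<in>W. (g x)\<^sup>2)"
    have "\<bar>g x\<bar> \<le> sqrt s" if "x \<in> W" for x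
      using member_le_sum[of x W "\<lambda>x. (g x)\<^sup>2"] that fin
      by (intro real_le_rsqrt) (simp add: s_def)
    then have "g x / sqrt s \<in> {-1..1}" if "x \<in> W" for x
      using that pos by (auto simp: s_def[symmetric] field_simps abs_le_iff minus_le_iff)
    moreover have "(\<Sum>x\<in>W. (if x \<in> W then g x / sqrt s else 0)\<^sup>2) = (\<Sum>x\<in>W. (g x)\<^sup>2 / s)"
      using pos by (intro sum.cong) (auto simp: power_divide s_def)
    moreover have "\<dots> = 1"
      using pos by (simp add: sum_divide_distrib[symmetric] s_def)
    ultimately show ?thesis
      unfolding s_def[symmetric] by (auto simp: P_def S_def PiE_iff)
  qed
  obtain w where w: "w \<in> W" using \<open>W \<noteq> {}\<close> by blast
  have "(\<Sum>x\<in>W. (indicator {w} x :: real)\<^sup>2) > 0"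
    using fin w by (intro sum_pos2[of _ w]) auto
  from normalized[OF this] have "P \<inter> S \<noteq> {}" by blast
  moreover have "continuous_on (P \<inter> S) Q"
    unfolding Q_def
    by (rule continuous_on_subset[OF _ subset_UNIV])
       (intro continuous_intros continuous_on_product_coordinates)
  ultimately obtain f where f: "f \<in> P \<inter> S" and least: "\<And>g. g \<in> P \<inter> S \<Longrightarrow> Q f \<le> Q g"
    using continuous_attains_inf[OF compact] by blast
  \<comment> \<open>Both sides scale quadratically, so minimality on the sphere extends to every g;
    if g vanishes on \<open>W\<close>, both sides are 0.\<close>
  have min: "Q f * (\<Sum>x\<in>W. (g x)\<^sup>2) \<le> (\<Sum>x\<in>W. g x * (\<Sum>y\<in>W. A x y * g y))" for g
  proof (cases "(\<Sum>x\<in>W. (g x)\<^sup>2) = 0")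
    case True
    then have "\<forall>x\<in>W. g x = 0"
      using fin by (simp add: sum_nonneg_eq_0_iff)
    then show ?thesis by simp
  next
    case False
    define s where "s = (\<Sum>x\<in>W. (g x)\<^sup>2)"
    have s: "s > 0"
      using False sum_nonneg[of W "\<lambda>x. (g x)\<^sup>2"] by (simp add: s_def order_less_le)
    have "Q f \<le> Q (\<lambda>x. if x \<in> W then g x / sqrt s else 0)"
      using least[OF normalized[OF s[unfolded s_def]]] unfolding s_def .
    also have "\<dots> = Q g / s"
      unfolding Q_def sum_divide_distrib sum_distrib_left
      using s by (intro sum.cong refl) (simp add: field_simps)
    finally have "Q f * s \<le> Q g" using s by (simp add: pos_le_divide_eq)
    then show ?thesis by (simp add: s_def Q_def)
  qed
  have norm: "(\<Sum>x\<in>W. (f x)\<^sup>2) = 1" using f by (simp add: S_def)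
  show ?thesis
  proof
    show "\<exists>x\<in>W. f x \<noteq> 0"
    proof (rule ccontr)
      assume "\<not> ?thesis"
      then have "(\<Sum>x\<in>W. (f x)\<^sup>2) = 0" by (intro sum.neutral) auto
      then show False using norm by simp
    qed
    show "f x = 0" if "x \<notin> W" for x
      using f that by (auto simp: P_def PiE_iff split: if_splits)
    show "(\<Sum>y\<in>W. A x y * f y) = Q f * f x" if "x \<in> W" for x
      using rayleigh_minimizer_eigenvector[OF fin sym min _ that] norm by (simp add: Q_def)
  qed (rule min)
qed

section \<open>Rayleigh quotient of the Dirichlet Laplacian\<close>

definition nbrs :: "'a pair_pre_digraph \<Rightarrow> 'a \<Rightarrow> 'a set" where
  "nbrs T x = {y. (x, y) \<in> parcs T}"

definition leaf_nbrs :: "'a pair_pre_digraph \<Rightarrow> 'a \<Rightarrow> 'a set" where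
  "leaf_nbrs T x = nbrs T x \<inter> boundary_verts T"

text \<open>
  For m the root of $m^2 - (k+1) m + 1$ in $(0, 1)$ and v the center, this is the first
  Dirichlet eigenfunction of the extremal tree; for m = 0 it is the indicator of the interior.
\<close>
definition vertex_dip :: "'a pair_pre_digraph \<Rightarrow> 'a \<Rightarrow> real \<Rightarrow> 'a \<Rightarrow> real" where
  "vertex_dip T v m x = (if x \<in> interior_verts T then if x = v then 1 - m else 1 else 0)"

lemma mem_nbrs_iff: "y \<in> nbrs T x \<longleftrightarrow> (x, y) \<in> parcs T"
  by (simp add: nbrs_def)

lemma out_degree_with_proj: "out_degree (with_proj T) x = card (nbrs T x)"
proof -
  have "out_arcs (with_proj T) x = Pair x ` nbrs T x"
    by (auto simp: nbrs_def)
  then show ?thesis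
    by (simp add: out_degree_def card_image inj_on_def)
qed

lemma boundary_verts_altdef:
  "boundary_verts T = {x \<in> pverts T. card (nbrs T x) = 1}"
  by (simp add: boundary_verts_def out_degree_with_proj)

text \<open>Since f vanishes on the leaves, a vertex where it is nonzero must be interior.\<close>

lemma dirichlet_eigenvalue_altdef:
  "dirichlet_eigenvalue T l \<longleftrightarrow>
     (\<exists>f. (\<exists>x\<in>interior_verts T. f x \<noteq> 0) \<and> (\<forall>x\<in>boundary_verts T. f x = 0) \<and>
        (\<forall>x\<in>interior_verts T. (\<Sum>y\<in>nbrs T x. f x - f y) = l * f x))"
  unfolding dirichlet_eigenvalue_def nbrs_def interior_verts_def by blast

context
  fixes T :: "'a pair_pre_digraph"
  assumes T: "pair_graph T"
begin

interpretation pair_graph T by (rule T)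

lemma nbrs_subset: "nbrs T x \<subseteq> pverts T"
  using arc_snd_in_verts by (fastforce simp: nbrs_def)

lemma finite_nbrs: "finite (nbrs T x)"
  using nbrs_subset pair_finite_verts by (rule finite_subset)

lemma nbrs_sym: "y \<in> nbrs T x \<longleftrightarrow> x \<in> nbrs T y"
  using pair_sym_arcs by (auto simp: nbrs_def symmetric_def dest: symD)

lemma nbrs_irrefl: "x \<notin> nbrs T x"
  using pair_no_loops by (fastforce simp: nbrs_def)

lemma finite_interior_verts: "finite (interior_verts T)"
  using pair_finite_verts by (simp add: interior_verts_def)

lemma finite_boundary_verts: "finite (boundary_verts T)"
  using pair_finite_verts by (simp add: boundary_verts_def)

lemma finite_leaf_nbrs: "finite (leaf_nbrs T x)"
  using finite_nbrs by (simp add: leaf_nbrs_def)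

lemma sum_nbrs_split:
  "sum h (nbrs T x) = sum h (leaf_nbrs T x) + sum h (nbrs T x \<inter> interior_verts T)"
proof -
  have "nbrs T x = leaf_nbrs T x \<union> (nbrs T x \<inter> interior_verts T)"
    using nbrs_subset by (auto simp: leaf_nbrs_def interior_verts_def)
  then have "sum h (nbrs T x) = sum h (leaf_nbrs T x \<union> (nbrs T x \<inter> interior_verts T))"
    by simp
  also have "\<dots> = sum h (leaf_nbrs T x) + sum h (nbrs T x \<inter> interior_verts T)"
    using finite_nbrs by (intro sum.union_disjoint) (auto simp: leaf_nbrs_def interior_verts_def)
  finally show ?thesis .
qed

text \<open>A common leaf would have two distinct neighbours, but its degree is one.\<close>

lemma leaf_nbrs_disjoint:
  assumes "x \<noteq> y"
  shows "leaf_nbrs T x \<inter> leaf_nbrs T y = {}"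
proof (rule ccontr)
  assume "\<not> ?thesis"
  then obtain z where z: "z \<in> leaf_nbrs T x" "z \<in> leaf_nbrs T y" by blast
  then have "x \<in> nbrs T z" "y \<in> nbrs T z"
    using nbrs_sym by (auto simp: leaf_nbrs_def)
  moreover have "card (nbrs T z) = 1"
    using z by (simp add: leaf_nbrs_def boundary_verts_altdef)
  ultimately show False
    using assms by (auto simp: card_1_singleton_iff)
qed

lemma card_UN_leaf_nbrs:
  "card (\<Union>x\<in>interior_verts T. leaf_nbrs T x) = (\<Sum>x\<in>interior_verts T. card (leaf_nbrs T x))"
  using finite_interior_verts finite_leaf_nbrs leaf_nbrs_disjoint
  by (intro card_UN_disjoint) auto

text \<open>By disjointness no leaf is counted twice. Equality may fail in a general
  \<open>pair_graph\<close>, where two leaves can be adjacent to each other.\<close>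

lemma sum_card_leaf_nbrs_le:
  "(\<Sum>x\<in>interior_verts T. card (leaf_nbrs T x)) \<le> card (boundary_verts T)"
  unfolding card_UN_leaf_nbrs[symmetric]
  using finite_boundary_verts by (intro card_mono) (auto simp: leaf_nbrs_def)

text \<open>The Dirichlet problem is the eigenvalue problem of a symmetric matrix indexed by the
  interior, so its least eigenvalue exists and has the variational characterization. This also shows
  that the \<open>LEAST\<close> over the reals is attained.\<close>

lemma first_dirichlet_eigenvalue_variational:
  assumes "interior_verts T \<noteq> {}"
  shows dirichlet_eigenvalue_first: "dirichlet_eigenvalue T (first_dirichlet_eigenvalue T)"
    and first_dirichlet_eigenvalue_rayleigh:
      "\<And>g. (\<And>x. x \<in> boundary_verts T \<Longrightarrow> g x = 0) \<Longrightarrow>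
        first_dirichlet_eigenvalue T * (\<Sum>x\<in>interior_verts T. (g x)\<^sup>2)
          \<le> (\<Sum>x\<in>interior_verts T. g x * (\<Sum>y\<in>nbrs T x. g x - g y))"
    and first_dirichlet_eigenvalue_rayleigh_eq:
      "\<And>g x. (\<And>x. x \<in> boundary_verts T \<Longrightarrow> g x = 0) \<Longrightarrow>
        (\<Sum>x\<in>interior_verts T. g x * (\<Sum>y\<in>nbrs T x. g x - g y))
          = first_dirichlet_eigenvalue T * (\<Sum>x\<in>interior_verts T. (g x)\<^sup>2) \<Longrightarrow>
        x \<in> interior_verts T \<Longrightarrow>
        (\<Sum>y\<in>nbrs T x. g x - g y) = first_dirichlet_eigenvalue T * g x"
proof -
  let ?W = "interior_verts T"
  \<comment> \<open>Degree minus adjacency. The diagonal carries the full degree, leaf neighbours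
    included; the columns of the leaves drop out because g vanishes there.\<close>
  define A where "A = (\<lambda>x y. (if y = x then real (card (nbrs T x)) else 0)
      - (if y \<in> nbrs T x then 1 else 0))"
  have sym: "A x y = A y x" for x y
    using nbrs_sym by (auto simp: A_def)
  have A: "(\<Sum>y\<in>?W. A x y * g y) = (\<Sum>y\<in>nbrs T x. g x - g y)"
    if g: "\<And>x. x \<in> boundary_verts T \<Longrightarrow> g x = 0" and x: "x \<in> ?W" for g x
  proof -
    have "(\<Sum>y\<in>?W. A x y * g y)
        = (\<Sum>y\<in>?W. (if y = x then card (nbrs T x) * g x else 0) - (if y \<in> nbrs T x then g y else 0))"
      by (intro sum.cong) (auto simp: A_def algebra_simps)
    also have "\<dots> = card (nbrs T x) * g x - (\<Sum>y\<in>nbrs T x \<inter> ?W. g y)"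
      using finite_interior_verts x
      by (simp add: sum_subtractf sum.inter_restrict[symmetric] Int_commute)
    also have "(\<Sum>y\<in>nbrs T x \<inter> ?W. g y) = (\<Sum>y\<in>nbrs T x. g y)"
      using g by (simp add: sum_nbrs_split[of g] leaf_nbrs_def)
    finally show ?thesis by (simp add: sum_subtractf)
  qed
  obtain l f where nz: "\<exists>x\<in>?W. f x \<noteq> 0" and off: "\<And>x. x \<notin> ?W \<Longrightarrow> f x = 0"
    and eig: "\<And>x. x \<in> ?W \<Longrightarrow> (\<Sum>y\<in>?W. A x y * f y) = l * f x"
    and min: "\<And>g. l * (\<Sum>x\<in>?W. (g x)\<^sup>2) \<le> (\<Sum>x\<in>?W. g x * (\<Sum>y\<in>?W. A x y * g y))"
    by (rule least_eigenvalue_exists[OF finite_interior_verts assms sym]) (rule that)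
  have f0: "f x = 0" if "x \<in> boundary_verts T" for x
    using off that by (simp add: interior_verts_def)
  have l: "dirichlet_eigenvalue T l"
    unfolding dirichlet_eigenvalue_altdef
  proof (intro exI[of _ f] conjI ballI)
    show "(\<Sum>y\<in>nbrs T x. f x - f y) = l * f x" if "x \<in> ?W" for x
      using eig[OF that] A[OF f0 that] by simp
  qed (use nz f0 in auto)
  \<comment> \<open>An eigenfunction for l' inserted into the Rayleigh inequality has quotient
    l'.\<close>
  moreover have "l \<le> l'" if "dirichlet_eigenvalue T l'" for l'
  proof -
    obtain h where h: "\<exists>x\<in>?W. h x \<noteq> 0" "\<And>x. x \<in> boundary_verts T \<Longrightarrow> h x = 0"
        "\<And>x. x \<in> ?W \<Longrightarrow> (\<Sum>y\<in>nbrs T x. h x - h y) = l' * h x"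
      using \<open>dirichlet_eigenvalue T l'\<close> unfolding dirichlet_eigenvalue_altdef by blast
    have "l * (\<Sum>x\<in>?W. (h x)\<^sup>2) \<le> (\<Sum>x\<in>?W. h x * (l' * h x))"
      using min[of h] A[OF h(2)] h(3) by simp
    also have "\<dots> = l' * (\<Sum>x\<in>?W. (h x)\<^sup>2)"
      by (simp add: sum_distrib_left power2_eq_square algebra_simps)
    finally have "l * (\<Sum>x\<in>?W. (h x)\<^sup>2) \<le> l' * (\<Sum>x\<in>?W. (h x)\<^sup>2)" .
    moreover have "(\<Sum>x\<in>?W. (h x)\<^sup>2) > 0"
    proof -
      obtain w where "w \<in> ?W" "h w \<noteq> 0" using h(1) by blast
      then show ?thesis
        using finite_interior_verts by (intro sum_pos2[of _ w]) auto
    qed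
    ultimately show ?thesis by simp
  qed
  ultimately have first: "first_dirichlet_eigenvalue T = l"
    unfolding first_dirichlet_eigenvalue_def by (rule Least_equality)
  show "dirichlet_eigenvalue T (first_dirichlet_eigenvalue T)"
    using l by (simp add: first)
  show "first_dirichlet_eigenvalue T * (\<Sum>x\<in>?W. (g x)\<^sup>2)
      \<le> (\<Sum>x\<in>?W. g x * (\<Sum>y\<in>nbrs T x. g x - g y))"
    if g: "\<And>x. x \<in> boundary_verts T \<Longrightarrow> g x = 0" for g
    using min[of g] A[OF g] by (simp add: first)
  show "(\<Sum>y\<in>nbrs T x. g x - g y) = first_dirichlet_eigenvalue T * g x"
    if g: "\<And>x. x \<in> boundary_verts T \<Longrightarrow> g x = 0"
      and eq: "(\<Sum>x\<in>?W. g x * (\<Sum>y\<in>nbrs T x. g x - g y))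
          = first_dirichlet_eigenvalue T * (\<Sum>x\<in>?W. (g x)\<^sup>2)"
      and x: "x \<in> ?W" for g x
  proof -
    have "(\<Sum>x\<in>?W. g x * (\<Sum>y\<in>?W. A x y * g y)) = l * (\<Sum>x\<in>?W. (g x)\<^sup>2)"
      using eq A[OF g] by (simp add: first)
    then have "(\<Sum>y\<in>?W. A x y * g y) = l * g x"
      using rayleigh_minimizer_eigenvector[OF finite_interior_verts sym min _ x] by blast
    then show ?thesis using A[OF g x] by (simp add: first)
  qed
qed

section \<open>Energy of the test function\<close>

lemma sum_nbrs_vertex_dip_center:
  fixes m :: real
  assumes v: "v \<in> interior_verts T"
  shows "(\<Sum>y\<in>nbrs T v. vertex_dip T v m v - vertex_dip T v m y)
    = (1 - m) * card (leaf_nbrs T v) - m * card (nbrs T v \<inter> interior_verts T)"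
proof -
  have "(\<Sum>y\<in>leaf_nbrs T v. vertex_dip T v m v - vertex_dip T v m y) = (\<Sum>y\<in>leaf_nbrs T v. 1 - m)"
    using v by (intro sum.cong) (auto simp: vertex_dip_def leaf_nbrs_def interior_verts_def)
  moreover have "(\<Sum>y\<in>nbrs T v \<inter> interior_verts T. vertex_dip T v m v - vertex_dip T v m y)
      = (\<Sum>y\<in>nbrs T v \<inter> interior_verts T. - m)"
    using v nbrs_irrefl[of v] by (intro sum.cong) (auto simp: vertex_dip_def)
  ultimately show ?thesis
    unfolding sum_nbrs_split by simp
qed

lemma sum_nbrs_vertex_dip_other:
  fixes m :: real
  assumes v: "v \<in> interior_verts T" and x: "x \<in> interior_verts T - {v}"
  shows "(\<Sum>y\<in>nbrs T x. vertex_dip T v m x - vertex_dip T v m y)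
    = card (leaf_nbrs T x) + (if x \<in> nbrs T v then m else 0)"
proof -
  have "(\<Sum>y\<in>leaf_nbrs T x. vertex_dip T v m x - vertex_dip T v m y) = (\<Sum>y\<in>leaf_nbrs T x. 1)"
    using x by (intro sum.cong) (auto simp: vertex_dip_def leaf_nbrs_def interior_verts_def)
  moreover have "(\<Sum>y\<in>nbrs T x \<inter> interior_verts T. vertex_dip T v m x - vertex_dip T v m y)
      = (\<Sum>y\<in>nbrs T x \<inter> interior_verts T. if y = v then m else 0)"
    using x by (intro sum.cong) (auto simp: vertex_dip_def)
  ultimately show ?thesis
    unfolding sum_nbrs_split using v nbrs_sym[of x v] finite_nbrs by simp
qed

lemma sum_vertex_dip_squared:
  fixes m :: real
  assumes v: "v \<in> interior_verts T"
  shows "(\<Sum>x\<in>interior_verts T. (vertex_dip T v m x)\<^sup>2)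
    = (1 - m)\<^sup>2 + (real (card (interior_verts T)) - 1)"
proof -
  have "card (interior_verts T) \<ge> 1"
    using v finite_interior_verts by (metis One_nat_def Suc_leI card_gt_0_iff empty_iff)
  moreover have "(\<Sum>x\<in>interior_verts T - {v}. (vertex_dip T v m x)\<^sup>2) = (\<Sum>x\<in>interior_verts T - {v}. 1)"
    by (intro sum.cong) (auto simp: vertex_dip_def)
  ultimately show ?thesis
    using v finite_interior_verts
    by (simp add: sum.remove[OF finite_interior_verts v] vertex_dip_def of_nat_diff)
qed

text \<open>Every edge from an interior vertex to a leaf contributes 1, or (1 - m)^2 if it starts at
  v; every edge from v to an interior vertex contributes m^2; the remaining interior edges
  contribute nothing.\<close>

lemma vertex_dip_energy:
  fixes m :: real
  assumes v: "v \<in> interior_verts T"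
  shows "(\<Sum>x\<in>interior_verts T. vertex_dip T v m x * (\<Sum>y\<in>nbrs T x. vertex_dip T v m x - vertex_dip T v m y))
    = (\<Sum>x\<in>interior_verts T. real (card (leaf_nbrs T x)))
      - (1 - (1 - m)\<^sup>2) * card (leaf_nbrs T v) + m\<^sup>2 * card (nbrs T v \<inter> interior_verts T)"
proof -
  let ?W = "interior_verts T" and ?d = "real (card (nbrs T v \<inter> interior_verts T))"
  have "(\<Sum>x\<in>?W - {v}. vertex_dip T v m x * (\<Sum>y\<in>nbrs T x. vertex_dip T v m x - vertex_dip T v m y))
      = (\<Sum>x\<in>?W - {v}. card (leaf_nbrs T x) + (if x \<in> nbrs T v then m else 0))"
    using sum_nbrs_vertex_dip_other[OF v] by (intro sum.cong) (auto simp: vertex_dip_def)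
  also have "\<dots> = (\<Sum>x\<in>?W - {v}. real (card (leaf_nbrs T x))) + m * ?d"
  proof -
    have "(?W - {v}) \<inter> nbrs T v = nbrs T v \<inter> ?W"
      using nbrs_irrefl by auto
    then show ?thesis
      using finite_interior_verts by (simp add: sum.distrib sum.inter_restrict[symmetric])
  qed
  finally have rest: "(\<Sum>x\<in>?W - {v}. vertex_dip T v m x * (\<Sum>y\<in>nbrs T x. vertex_dip T v m x - vertex_dip T v m y))
      = (\<Sum>x\<in>?W - {v}. real (card (leaf_nbrs T x))) + m * ?d" .
  have center: "vertex_dip T v m v = 1 - m" using v by (simp add: vertex_dip_def)
  show ?thesis
    unfolding sum.remove[OF finite_interior_verts v] rest center
      sum_nbrs_vertex_dip_center[OF v, of m, unfolded center]
    by (simp add: power2_eq_square algebra_simps)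
qed

end

section \<open>The upper bound\<close>

context
  fixes T :: "'a pair_pre_digraph"
  assumes T: "pair_graph T"
begin

text \<open>The root equation makes a + m the quotient for a + 1 leaves and k - 1 interior
  neighbours at v; any other admissible count only lowers it. Both conclusions are proved together
  because the equality case reuses the chain of inequalities behind the bound.\<close>

lemma first_dirichlet_eigenvalue_le:
  fixes a k :: nat and m :: real
  assumes k: "card (interior_verts T) = k" "k \<ge> 1"
    and b: "card (boundary_verts T) = a * k + 1"
    and m: "0 < m" "m < 1" and root: "m\<^sup>2 - (real k + 1) * m + 1 = 0"
  shows "first_dirichlet_eigenvalue T \<le> real a + m"
    and "first_dirichlet_eigenvalue T = real a + m \<Longrightarrow>
      \<exists>v\<in>interior_verts T. card (leaf_nbrs T v) = a + 1 \<and>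
        (\<forall>x\<in>interior_verts T - {v}. x \<in> nbrs T v \<and> card (leaf_nbrs T x) = a)"
proof -
  let ?W = "interior_verts T" and ?l = "first_dirichlet_eigenvalue T"
  let ?S = "(1 - m)\<^sup>2 + (real k - 1)"
  have ne: "?W \<noteq> {}" using k by auto
  have S: "?S > 0" using m k by (intro add_pos_nonneg) auto
  have "?l \<le> real a + m \<and> (?l = real a + m \<longrightarrow>
      (\<exists>v\<in>?W. card (leaf_nbrs T v) = a + 1 \<and>
        (\<forall>x\<in>?W - {v}. x \<in> nbrs T v \<and> card (leaf_nbrs T x) = a)))"
  proof (cases "\<exists>v\<in>?W. a + 1 \<le> card (leaf_nbrs T v)")
    \<comment> \<open>With m = 0 the quotient is the mean number of leaf neighbours per interior
      vertex, at most a and so strictly below a + m; equality cannot occur here.\<close>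
    case False
    obtain v where v: "v \<in> ?W" using ne by blast
    have zero: "vertex_dip T v 0 x = 0" if "x \<in> boundary_verts T" for x
      using that by (simp add: vertex_dip_def interior_verts_def)
    have "?l * real k \<le> (\<Sum>x\<in>?W. real (card (leaf_nbrs T x)))"
      using first_dirichlet_eigenvalue_rayleigh[OF T ne, of "vertex_dip T v 0", OF zero]
      by (simp add: vertex_dip_energy[OF T v] sum_vertex_dip_squared[OF T v] k)
    also have "\<dots> \<le> (\<Sum>x\<in>?W. real a)"
      using False by (intro sum_mono) (auto simp: not_le)
    also have "\<dots> = real a * real k" using k by simp
    finally have "?l \<le> real a" using k by simp
    then show ?thesis using m by simp
  next
    case True
    then obtain v where v: "v \<in> ?W" and lv: "a + 1 \<le> card (leaf_nbrs T v)" by blast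
    let ?f = "vertex_dip T v m"
    define d where "d = card (nbrs T v \<inter> ?W)"
    \<comment> \<open>The energy with the number of edges from the interior to leaves replaced by
      its upper bound, the number of leaves.\<close>
    define R where "R = real (a * k + 1) - (1 - (1 - m)\<^sup>2) * card (leaf_nbrs T v) + m\<^sup>2 * real d"
    define E where "E = (\<Sum>x\<in>?W. ?f x * (\<Sum>y\<in>nbrs T x. ?f x - ?f y))"
    have zero: "?f x = 0" if "x \<in> boundary_verts T" for x
      using that by (simp add: vertex_dip_def interior_verts_def)
    have lE: "?l * ?S \<le> E"
      using first_dirichlet_eigenvalue_rayleigh[OF T ne, of ?f, OF zero] k
      by (simp add: E_def sum_vertex_dip_squared[OF T v])
    have "(\<Sum>x\<in>?W. real (card (leaf_nbrs T x))) \<le> real (a * k + 1)"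
      using sum_card_leaf_nbrs_le[OF T] b by (simp only: of_nat_sum[symmetric] of_nat_le_iff)
    then have ER: "E \<le> R"
      unfolding E_def vertex_dip_energy[OF T v] R_def d_def by simp
    have sub: "nbrs T v \<inter> ?W \<subseteq> ?W - {v}"
      using nbrs_irrefl[OF T] by blast
    have cardW: "card (?W - {v}) = k - 1"
      using v k by simp
    have d: "d \<le> k - 1"
      unfolding d_def cardW[symmetric]
      using sub finite_interior_verts[OF T] by (intro card_mono) auto
    have c: "1 - (1 - m)\<^sup>2 > 0"
    proof -
      have "(1 - m)\<^sup>2 < 1" using m by (simp add: power_less_one_iff)
      then show ?thesis by simp
    qed
    \<comment> \<open>The two terms measure the surplus of leaves at v and the interior vertices not
      adjacent to v. The two sides differ by a multiple of the polynomial that vanishes at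
      m.\<close>
    have slack: "(real a + m) * ?S - R = (1 - (1 - m)\<^sup>2) * (real (card (leaf_nbrs T v)) - (real a + 1))
        + m\<^sup>2 * (real k - 1 - real d)"
    proof -
      have "(real a + m) * ?S - R - ((1 - (1 - m)\<^sup>2) * (real (card (leaf_nbrs T v)) - (real a + 1))
        + m\<^sup>2 * (real k - 1 - real d)) = - (1 - m) * (m\<^sup>2 - (real k + 1) * m + 1)"
        by (simp add: R_def power2_eq_square algebra_simps)
      then show ?thesis by (simp add: root)
    qed
    have nonneg: "0 \<le> (1 - (1 - m)\<^sup>2) * (real (card (leaf_nbrs T v)) - (real a + 1))"
        "0 \<le> m\<^sup>2 * (real k - 1 - real d)"
      using c lv d k by auto
    have le: "?l * ?S \<le> (real a + m) * ?S"
      using lE ER slack nonneg by linarith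
    have "\<exists>v\<in>?W. card (leaf_nbrs T v) = a + 1 \<and>
        (\<forall>x\<in>?W - {v}. x \<in> nbrs T v \<and> card (leaf_nbrs T x) = a)" if l: "?l = real a + m"
    proof -
      \<comment> \<open>The chain \<open>?l * ?S \<le> E \<le> R \<le> (real a + m) * ?S\<close>
        collapses. Hence the test function is a minimizer, thus an eigenfunction, and below both
        slack terms vanish.\<close>
      have "E = ?l * ?S"
        using lE ER slack nonneg l by (simp add: l)
      then have eig: "(\<Sum>y\<in>nbrs T x. ?f x - ?f y) = ?l * ?f x" if "x \<in> ?W" for x
        using first_dirichlet_eigenvalue_rayleigh_eq[OF T ne, of ?f, OF zero _ that] k
        by (simp add: E_def sum_vertex_dip_squared[OF T v])
      have "(real a + m) * ?S \<le> R" using lE ER l by simp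
      then have "(1 - (1 - m)\<^sup>2) * (real (card (leaf_nbrs T v)) - (real a + 1)) = 0"
          "m\<^sup>2 * (real k - 1 - real d) = 0"
        using slack nonneg by linarith+
      then have lv': "card (leaf_nbrs T v) = a + 1" and d': "d = k - 1"
        using c m k by (auto simp: of_nat_diff)
      have nbrs_v: "nbrs T v \<inter> ?W = ?W - {v}"
        using sub d' cardW finite_interior_verts[OF T] unfolding d_def
        by (intro card_subset_eq) auto
      have "x \<in> nbrs T v \<and> card (leaf_nbrs T x) = a" if x: "x \<in> ?W - {v}" for x
      proof -
        have adj: "x \<in> nbrs T v" using nbrs_v x by blast
        \<comment> \<open>The test function is 1 at x, so its eigenvalue equation at x just counts
          leaves.\<close>
        have "real (card (leaf_nbrs T x)) + m = real a + m"
          using eig[of x] sum_nbrs_vertex_dip_other[OF T v x, of m] x adj l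
          by (simp add: vertex_dip_def)
        then show ?thesis using adj by simp
      qed
      then show ?thesis using v lv' by blast
    qed
    then show ?thesis using le S by simp
  qed
  then show "?l \<le> real a + m" and "?l = real a + m \<Longrightarrow>
      \<exists>v\<in>?W. card (leaf_nbrs T v) = a + 1 \<and>
        (\<forall>x\<in>?W - {v}. x \<in> nbrs T v \<and> card (leaf_nbrs T x) = a)"
    by blast+
qed

end

section \<open>Isomorphism invariance\<close>

text \<open>Library isomorphisms carry separate maps for vertices, arcs, tails and heads. With the
  projections as tail and head on both sides, the vertex map determines the arc map on all
  arcs.\<close>

lemma digraph_iso_with_proj_iff:
  assumes "pair_wf_digraph G"
  shows "digraph_iso (with_proj G) (with_proj H) \<longleftrightarrow>
    (\<exists>h. inj_on h (pverts G) \<and> pverts H = h ` pverts G \<and> parcs H = map_prod h h ` parcs G)"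
proof
  interpret pair_wf_digraph G by (rule assms)
  assume "digraph_iso (with_proj G) (with_proj H)"
  then obtain f where f: "digraph_isomorphism f" and H: "with_proj H = app_iso f (with_proj G)"
    unfolding digraph_iso_def by blast
  have "iso_tail f = fst" "iso_head f = snd"
    using arg_cong[OF H, of tail] arg_cong[OF H, of head] by simp_all
  then have "iso_arcs f e = map_prod (iso_verts f) (iso_verts f) e" if "e \<in> parcs G" for e
    using f that by (intro prod_eqI) (auto simp: digraph_isomorphism_def)
  then have "parcs H = map_prod (iso_verts f) (iso_verts f) ` parcs G"
    using arg_cong[OF H, of arcs] by (auto intro!: image_cong)
  moreover have "pverts H = iso_verts f ` pverts G"
    using arg_cong[OF H, of verts] by simp
  moreover have "inj_on (iso_verts f) (pverts G)"
    using f by (simp add: digraph_isomorphism_def)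
  ultimately show "\<exists>h. inj_on h (pverts G) \<and> pverts H = h ` pverts G \<and> parcs H = map_prod h h ` parcs G"
    by blast
next
  interpret pair_wf_digraph G by (rule assms)
  assume "\<exists>h. inj_on h (pverts G) \<and> pverts H = h ` pverts G \<and> parcs H = map_prod h h ` parcs G"
  then obtain h where h: "inj_on h (pverts G)" "pverts H = h ` pverts G" "parcs H = map_prod h h ` parcs G"
    by blast
  let ?f = "\<lparr>iso_verts = h, iso_arcs = map_prod h h, iso_head = snd, iso_tail = fst\<rparr>"
  have "inj_on (map_prod h h) (parcs G)"
    using arc_fst_in_verts arc_snd_in_verts inj_onD[OF h(1)]
    by (intro inj_onI) (fastforce intro: prod_eqI)
  then have "digraph_isomorphism ?f"
    using h(1) wf_digraph_axioms by (auto simp: digraph_isomorphism_def)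
  moreover have "with_proj H = app_iso ?f (with_proj G)"
    using h by (simp add: with_proj_def app_iso_def)
  ultimately show "digraph_iso (with_proj G) (with_proj H)"
    unfolding digraph_iso_def by blast
qed

text \<open>The vertex map carries neighbourhoods to neighbourhoods, hence leaves to leaves and
  interior to interior, so an eigenfunction can be transported along its inverse.\<close>

lemma dirichlet_eigenvalue_iso:
  assumes G: "pair_wf_digraph G" and iso: "digraph_iso (with_proj G) (with_proj H)"
    and eig: "dirichlet_eigenvalue G l"
  shows "dirichlet_eigenvalue H l"
proof -
  interpret pair_wf_digraph G by (rule G)
  obtain h where inj: "inj_on h (pverts G)" and verts: "pverts H = h ` pverts G"
      and arcs: "parcs H = map_prod h h ` parcs G"
    using iso unfolding digraph_iso_with_proj_iff[OF G] by blast
  obtain f where f: "\<exists>x\<in>interior_verts G. f x \<noteq> 0" "\<forall>x\<in>boundary_verts G. f x = 0"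
      "\<forall>x\<in>interior_verts G. (\<Sum>y\<in>nbrs G x. f x - f y) = l * f x"
    using eig unfolding dirichlet_eigenvalue_altdef by blast
  have sub: "nbrs G x \<subseteq> pverts G" for x
    using arc_snd_in_verts by (fastforce simp: nbrs_def)
  have nbrs: "nbrs H (h x) = h ` nbrs G x" if "x \<in> pverts G" for x
  proof
    show "nbrs H (h x) \<subseteq> h ` nbrs G x"
    proof
      fix y assume "y \<in> nbrs H (h x)"
      then obtain u w where uw: "(u, w) \<in> parcs G" "h u = h x" "y = h w"
        by (auto simp: nbrs_def arcs)
      have "u = x"
        using uw(2) that arc_fst_in_verts[OF uw(1)] inj by (auto dest: inj_onD)
      then show "y \<in> h ` nbrs G x" using uw by (auto simp: nbrs_def)
    qed
    show "h ` nbrs G x \<subseteq> nbrs H (h x)"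
      by (force simp: nbrs_def arcs)
  qed
  have card: "card (nbrs H (h x)) = card (nbrs G x)" if "x \<in> pverts G" for x
    unfolding nbrs[OF that] using inj sub by (intro card_image) (blast intro: inj_on_subset)
  have boundary: "boundary_verts H = h ` boundary_verts G"
    using card by (auto simp: boundary_verts_altdef verts)
  have interior: "interior_verts H = h ` interior_verts G"
    unfolding interior_verts_def verts boundary
    using inj by (subst inj_on_image_set_diff) (auto simp: boundary_verts_def)
  define g where "g = the_inv_into (pverts G) h"
  have g: "g (h x) = x" if "x \<in> pverts G" for x
    using the_inv_into_f_f[OF inj that] by (simp add: g_def)
  show ?thesis
    unfolding dirichlet_eigenvalue_altdef
  proof (intro exI[of _ "f \<circ> g"] conjI ballI)
    show "\<exists>x\<in>interior_verts H. (f \<circ> g) x \<noteq> 0"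
    proof -
      obtain z where z: "z \<in> interior_verts G" "f z \<noteq> 0" using f(1) by blast
      then have "g (h z) = z" using g by (simp add: interior_verts_def)
      then show ?thesis using z interior by (intro bexI[of _ "h z"]) auto
    qed
    show "(f \<circ> g) x = 0" if x: "x \<in> boundary_verts H" for x
    proof -
      obtain z where z: "z \<in> boundary_verts G" "x = h z" using x boundary by blast
      then have "g x = z" using g by (simp add: boundary_verts_def)
      then show ?thesis using z f(2) by simp
    qed
    show "(\<Sum>y\<in>nbrs H x. (f \<circ> g) x - (f \<circ> g) y) = l * (f \<circ> g) x" if x: "x \<in> interior_verts H" for x
    proof -
      obtain z where z: "z \<in> interior_verts G" "x = h z" using x interior by blast
      have zv: "z \<in> pverts G" using z by (simp add: interior_verts_def)
      have "(\<Sum>y\<in>nbrs H x. (f \<circ> g) x - (f \<circ> g) y) = (\<Sum>y\<in>nbrs G z. f z - f (g (h y)))"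
        unfolding z nbrs[OF zv] using inj sub g[OF zv]
        by (subst sum.reindex) (auto intro: inj_on_subset)
      also have "\<dots> = (\<Sum>y\<in>nbrs G z. f z - f y)"
        using g subsetD[OF sub] by (intro sum.cong) auto
      finally show ?thesis using f(3) z g[OF zv] by simp
    qed
  qed
qed

section \<open>The star-like tree\<close>

text \<open>Writing the arcs as a union of rectangles prepares the comparison with the image of the
  arcs of a tree under a product map.\<close>

lemma slp_arcs_star:
  "slp_arcs p q 0 d 0 = {Spine 0} \<times> Lft ` {1..d} \<union> {Spine 0} \<times> Pendant (Spine 0) ` {1..p}
    \<union> (\<Union>u\<in>Lft ` {1..d}. {u} \<times> Pendant u ` {1..q})"
  by (auto simp: slp_arcs_def slp_ends_def slp_others_def)

lemma pverts_SLP_star: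
  "pverts (SLP p q 0 d 0) = insert (Spine 0) (Lft ` {1..d}) \<union> Pendant (Spine 0) ` {1..p}
    \<union> (\<Union>u\<in>Lft ` {1..d}. Pendant u ` {1..q})"
  by (auto simp: SLP_def slp_ends_def slp_others_def)

lemma parcs_SLP: "parcs (SLP p q c d e) = slp_arcs p q c d e \<union> (slp_arcs p q c d e)\<inverse>"
  by (simp add: SLP_def)

lemma nbrs_SLP_star_center:
  "nbrs (SLP p q 0 d 0) (Spine 0) = Lft ` {1..d} \<union> Pendant (Spine 0) ` {1..p}"
  by (auto simp: nbrs_def parcs_SLP slp_arcs_star)

lemma nbrs_SLP_star_arm:
  assumes "i \<in> {1..d}"
  shows "nbrs (SLP p q 0 d 0) (Lft i) = insert (Spine 0) (Pendant (Lft i) ` {1..q})"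
  using assms by (auto simp: nbrs_def parcs_SLP slp_arcs_star)

lemma nbrs_SLP_star_pendant:
  assumes "Pendant u i \<in> pverts (SLP p q 0 d 0)"
  shows "nbrs (SLP p q 0 d 0) (Pendant u i) = {u}"
  using assms by (auto simp: nbrs_def parcs_SLP slp_arcs_star pverts_SLP_star)

lemma card_nbrs_SLP_star:
  shows "card (nbrs (SLP p q 0 d 0) (Spine 0)) = d + p"
    and "i \<in> {1..d} \<Longrightarrow> card (nbrs (SLP p q 0 d 0) (Lft i)) = Suc q"
proof -
  have "card (Lft ` {1..d} \<union> Pendant (Spine 0) ` {1..p}) = card (Lft ` {1..d}) + card (Pendant (Spine 0) ` {1..p})"
    by (intro card_Un_disjoint) auto
  then show "card (nbrs (SLP p q 0 d 0) (Spine 0)) = d + p"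
    by (simp add: nbrs_SLP_star_center card_image inj_on_def)
  show "card (nbrs (SLP p q 0 d 0) (Lft i)) = Suc q" if "i \<in> {1..d}"
  proof -
    have "Spine 0 \<notin> Pendant (Lft i) ` {1..q}" by auto
    then show ?thesis
      by (simp add: nbrs_SLP_star_arm[OF that] card_image inj_on_def)
  qed
qed

text \<open>Arms have degree q + 1, at least 2, and the center has degree d + p, which is not 1; so
  the pendant vertices are the only leaves.\<close>

lemma SLP_star_partition:
  assumes "q \<ge> 1" and "d + p \<noteq> 1"
  shows "interior_verts (SLP p q 0 d 0) = insert (Spine 0) (Lft ` {1..d})"
    and "boundary_verts (SLP p q 0 d 0) = Pendant (Spine 0) ` {1..p} \<union> (\<Union>u\<in>Lft ` {1..d}. Pendant u ` {1..q})"
proof -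
  show B: "boundary_verts (SLP p q 0 d 0) = Pendant (Spine 0) ` {1..p} \<union> (\<Union>u\<in>Lft ` {1..d}. Pendant u ` {1..q})"
    (is "_ = ?P")
  proof
    show "boundary_verts (SLP p q 0 d 0) \<subseteq> ?P"
      using assms by (auto simp: boundary_verts_altdef pverts_SLP_star card_nbrs_SLP_star)
    show "?P \<subseteq> boundary_verts (SLP p q 0 d 0)"
    proof
      fix x assume "x \<in> ?P"
      then have x: "x \<in> pverts (SLP p q 0 d 0)"
        unfolding pverts_SLP_star by blast
      obtain u i where "x = Pendant u i" using \<open>x \<in> ?P\<close> by blast
      then show "x \<in> boundary_verts (SLP p q 0 d 0)"
        using x nbrs_SLP_star_pendant by (simp add: boundary_verts_altdef)
    qed
  qed
  show "interior_verts (SLP p q 0 d 0) = insert (Spine 0) (Lft ` {1..d})"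
    unfolding interior_verts_def B by (auto simp: pverts_SLP_star)
qed

text \<open>Eliminating pendants and arms leaves the scalar equation (k - 1) (c - 1) + c^2 = 0 for c
  = 1 + a - l. Its left side is increasing for c > 0 and vanishes at c = 1 - m, whereas l < a + m
  would mean c > 1 - m.\<close>

lemma SLP_star_eigenvalue_ge:
  fixes a k :: nat and m :: real
  assumes "a \<ge> 1" and k: "k \<ge> 2"
    and m: "m < 1" and root: "m\<^sup>2 - (real k + 1) * m + 1 = 0"
    and eig: "dirichlet_eigenvalue (SLP (a + 1) a 0 (k - 1) 0) l"
  shows "l \<ge> real a + m"
proof (rule ccontr)
  assume "\<not> ?thesis"
  let ?G = "SLP (a + 1) a 0 (k - 1) 0"
  have "k - 1 + (a + 1) \<noteq> 1" using k by simp
  note partition = SLP_star_partition[OF \<open>a \<ge> 1\<close> this]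
  obtain f where nz: "\<exists>x\<in>interior_verts ?G. f x \<noteq> 0" and zero: "\<And>x. x \<in> boundary_verts ?G \<Longrightarrow> f x = 0"
      and f: "\<And>x. x \<in> interior_verts ?G \<Longrightarrow> (\<Sum>y\<in>nbrs ?G x. f x - f y) = l * f x"
    using eig unfolding dirichlet_eigenvalue_altdef by blast
  \<comment> \<open>The equation at an arm reads c times the arm value = center value; c > 0 allows
    dividing.\<close>
  define c where "c = 1 + real a - l"
  have c: "c > 1 - m" "c > 0" using \<open>\<not> l \<ge> real a + m\<close> m by (auto simp: c_def)
  have arm: "f (Lft i) = f (Spine 0) / c" if i: "i \<in> {1..k - 1}" for i
  proof -
    have "Lft i \<in> interior_verts ?G" using i partition by simp
    from f[OF this] have "l * f (Lft i) = (f (Lft i) - f (Spine 0)) + (\<Sum>y\<in>Pendant (Lft i) ` {1..a}. f (Lft i) - f y)"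
      unfolding nbrs_SLP_star_arm[OF i] by (subst (asm) sum.insert) auto
    also have "(\<Sum>y\<in>Pendant (Lft i) ` {1..a}. f (Lft i) - f y) = (\<Sum>y\<in>Pendant (Lft i) ` {1..a}. f (Lft i))"
    proof (intro sum.cong refl)
      fix y assume "y \<in> Pendant (Lft i) ` {1..a}"
      then have "y \<in> boundary_verts ?G" unfolding partition(2) using i by blast
      then show "f (Lft i) - f y = f (Lft i)" using zero by simp
    qed
    also have "\<dots> = real a * f (Lft i)"
      by (simp add: card_image inj_on_def)
    finally show ?thesis using c by (simp add: c_def field_simps)
  qed
  have "l * f (Spine 0) = (\<Sum>y\<in>Lft ` {1..k - 1}. f (Spine 0) - f y)
      + (\<Sum>y\<in>Pendant (Spine 0) ` {1..a + 1}. f (Spine 0) - f y)"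
    unfolding f[of "Spine 0", unfolded partition, OF insertI1, symmetric] nbrs_SLP_star_center
    by (intro sum.union_disjoint) auto
  also have "(\<Sum>y\<in>Lft ` {1..k - 1}. f (Spine 0) - f y) = (\<Sum>y\<in>Lft ` {1..k - 1}. f (Spine 0) - f (Spine 0) / c)"
    using arm by (intro sum.cong) auto
  also have "\<dots> = (real k - 1) * (f (Spine 0) - f (Spine 0) / c)"
    using k by (simp add: card_image inj_on_def of_nat_diff)
  also have "(\<Sum>y\<in>Pendant (Spine 0) ` {1..a + 1}. f (Spine 0) - f y) = (\<Sum>y\<in>Pendant (Spine 0) ` {1..a + 1}. f (Spine 0))"
    using zero partition(2) by (intro sum.cong) auto
  also have "\<dots> = (real a + 1) * f (Spine 0)"
    by (simp add: card_image inj_on_def)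
  finally have "f (Spine 0) * ((real k - 1) * (c - 1) + c * c) = 0"
    using c by (simp add: c_def field_simps)
  \<comment> \<open>If the center value were 0, all arm values would be 0 as well.\<close>
  moreover have "f (Spine 0) \<noteq> 0"
    using nz arm unfolding partition(1) by auto
  ultimately have char: "(real k - 1) * (c - 1) + c * c = 0" by simp
  have "(real k - 1) * (1 - m - 1) + (1 - m) * (1 - m) = m\<^sup>2 - (real k + 1) * m + 1"
    by (simp add: power2_eq_square algebra_simps)
  also have "\<dots> = (real k - 1) * (c - 1) + c * c" by (simp add: root char)
  finally have "(real k - 1) * (1 - m - 1) + (1 - m) * (1 - m) = (real k - 1) * (c - 1) + c * c" .
  moreover have "(real k - 1) * (1 - m - 1) < (real k - 1) * (c - 1)"
    using c k by (intro mult_strict_left_mono) auto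
  moreover have "(1 - m) * (1 - m) \<le> c * c"
    using c m by (intro mult_mono) auto
  ultimately show False by linarith
qed

section \<open>Recognizing the extremal tree\<close>

lemma simple_tree_triangle_free:
  assumes T: "simple_tree T" and "y \<in> nbrs T x" "z \<in> nbrs T y"
  shows "x \<notin> nbrs T z"
proof
  assume "x \<in> nbrs T z"
  interpret pair_graph T using T by (simp add: simple_tree_def)
  \<comment> \<open>A triangle is a closed walk of length 3, the shortest length that
    \<open>simple_tree\<close> forbids.\<close>
  let ?c = "[(x, y), (y, z), (z, x)]"
  have arcs: "(x, y) \<in> parcs T" "(y, z) \<in> parcs T" "(z, x) \<in> parcs T"
    using assms(2,3) \<open>x \<in> nbrs T z\<close> by (auto simp: nbrs_def)
  have "x \<noteq> y" "y \<noteq> z" "z \<noteq> x"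
    using arcs[THEN pair_no_loops] by auto
  moreover have "x \<in> pverts T" using arc_fst_in_verts[OF arcs(1)] by simp
  ultimately have "cycle ?c"
    using arcs unfolding cycle_def awalk_def by (intro exI[of _ x]) auto
  moreover have "length ?c \<ge> 3" by simp
  ultimately show False using T unfolding simple_tree_def by blast
qed

text \<open>The prescribed leaf counts exhaust all leaves, and an edge between two arms would close
  a triangle with v. This fixes all edges, and enumerating arms and leaves gives the
  isomorphism.\<close>

lemma digraph_iso_SLP_star:
  assumes tree: "simple_tree T"
    and k: "card (interior_verts T) = k" and b: "card (boundary_verts T) = a * k + 1"
    and v: "v \<in> interior_verts T" and lv: "card (leaf_nbrs T v) = a + 1"
    and star: "\<And>x. x \<in> interior_verts T - {v} \<Longrightarrow> x \<in> nbrs T v \<and> card (leaf_nbrs T x) = a"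
  shows "digraph_iso (with_proj T) (with_proj (SLP (a + 1) a 0 (k - 1) 0))"
proof -
  let ?W = "interior_verts T"
  have T: "pair_graph T" using tree by (simp add: simple_tree_def)
  interpret pair_graph T by (rule T)
  note fin = finite_interior_verts[OF T] finite_leaf_nbrs[OF T] finite_boundary_verts[OF T]
  have disj: "x = x'" if "y \<in> leaf_nbrs T x" "y \<in> leaf_nbrs T x'" for x x' y
    using leaf_nbrs_disjoint[OF T, of x x'] that by blast
  have "k \<ge> 1" using k v fin(1) by (metis One_nat_def Suc_leI card_gt_0_iff empty_iff)
  have cardW: "card (?W - {v}) = k - 1" using v k by simp
  \<comment> \<open>Since (a + 1) + (k - 1) a = a k + 1, the disjoint leaf neighbourhoods cover the
    boundary.\<close>
  have "(\<Sum>x\<in>?W. card (leaf_nbrs T x)) = (a + 1) + (\<Sum>x\<in>?W - {v}. a)"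
    unfolding sum.remove[OF fin(1) v] lv using star by (intro arg_cong2[of _ _ _ _ "(+)"] sum.cong) auto
  also have "\<dots> = card (boundary_verts T)"
    using \<open>k \<ge> 1\<close> by (cases k) (simp_all add: cardW b)
  finally have leaves: "(\<Union>x\<in>?W. leaf_nbrs T x) = boundary_verts T"
    unfolding card_UN_leaf_nbrs[OF T, symmetric]
    using fin(3) by (intro card_subset_eq) (auto simp: leaf_nbrs_def)
  have vertsT: "pverts T = ?W \<union> (\<Union>x\<in>?W. leaf_nbrs T x)"
    unfolding leaves by (auto simp: interior_verts_def boundary_verts_def)
  have WB: "y \<notin> ?W" if "y \<in> leaf_nbrs T x" for x y
    using that by (simp add: leaf_nbrs_def interior_verts_def)
  \<comment> \<open>Each edge oriented away from v, matching the orientation in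
    \<open>slp_arcs\<close>.\<close>
  define E where "E = {v} \<times> (?W - {v}) \<union> (\<Union>x\<in>?W. {x} \<times> leaf_nbrs T x)"
  have arcsT: "parcs T = E \<union> E\<inverse>"
  proof
    have "E \<subseteq> parcs T"
      using star by (auto simp: E_def leaf_nbrs_def mem_nbrs_iff)
    moreover have "E\<inverse> \<subseteq> (parcs T)\<inverse>" using calculation by blast
    moreover have "(parcs T)\<inverse> = parcs T"
      using pair_sym_arcs by (simp add: symmetric_def sym_conv_converse_eq)
    ultimately show "E \<union> E\<inverse> \<subseteq> parcs T" by simp
    \<comment> \<open>The leaf y also hangs at some interior z; as it has only one neighbour, x = z
      is interior.\<close>
    have leafE: "(x, y) \<in> E" if x: "x \<in> nbrs T y" and y: "y \<in> boundary_verts T" for x y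
    proof -
      obtain z where z: "z \<in> ?W" "y \<in> leaf_nbrs T z"
        using y unfolding leaves[symmetric] by blast
      have "y \<in> leaf_nbrs T x"
        using x y nbrs_sym[OF T, of x y] by (simp add: leaf_nbrs_def)
      then have "x \<in> ?W" using disj[OF z(2)] z(1) by metis
      then show ?thesis using \<open>y \<in> leaf_nbrs T x\<close> by (auto simp: E_def)
    qed
    show "parcs T \<subseteq> E \<union> E\<inverse>"
    proof (rule subrelI, rule UnCI)
      fix x y assume xy: "(x, y) \<in> parcs T" and "(x, y) \<notin> E\<inverse>"
      then have notin: "(y, x) \<notin> E" by simp
      have adj: "y \<in> nbrs T x" "x \<in> nbrs T y"
        using xy nbrs_sym[OF T, of y x] by (simp_all add: mem_nbrs_iff)
      have xyB: "x \<notin> boundary_verts T"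
        using leafE[OF adj(1)] notin by blast
      show "(x, y) \<in> E"
      proof (cases "y \<in> boundary_verts T")
        case True
        then show ?thesis using leafE[OF adj(2)] by blast
      next
        case False
        then have W: "x \<in> ?W" "y \<in> ?W"
          using xyB arc_fst_in_verts[OF xy] arc_snd_in_verts[OF xy] by (auto simp: interior_verts_def)
        have "x \<noteq> y" using adj nbrs_irrefl[OF T] by blast
        have "y \<noteq> v" using notin W \<open>x \<noteq> y\<close> by (auto simp: E_def)
        \<comment> \<open>Otherwise v, x, y would form a triangle.\<close>
        moreover have "x = v"
        proof (rule ccontr)
          assume "x \<noteq> v"
          then have "x \<in> nbrs T v" "y \<in> nbrs T v" using star W \<open>y \<noteq> v\<close> by auto
          then show False
            using simple_tree_triangle_free[OF tree _ adj(1), of v] nbrs_sym[OF T] by blast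
        qed
        ultimately show ?thesis using W by (simp add: E_def)
      qed
    qed
  qed
  obtain n where n: "bij_betw n (?W - {v}) {1..k - 1}"
    using finite_same_card_bij[of "?W - {v}" "{1..k - 1}"] fin(1) cardW by auto
  have "\<exists>g. bij_betw g (leaf_nbrs T x) {1..card (leaf_nbrs T x)}" for x
    using fin(2) by (intro finite_same_card_bij) auto
  then obtain g where g: "\<And>x. bij_betw (g x) (leaf_nbrs T x) {1..card (leaf_nbrs T x)}"
    by metis
  define u where "u = (\<lambda>x. if x = v then Spine 0 else Lft (n x))"
  \<comment> \<open>Well defined on leaves, each having a single neighbour.\<close>
  define parent where "parent = (\<lambda>y. THE x. y \<in> leaf_nbrs T x)"
  have parent: "parent y = x" if "y \<in> leaf_nbrs T x" for x y
    unfolding parent_def using that disj by (intro the_equality)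
  define h where "h = (\<lambda>x. if x \<in> ?W then u x else Pendant (u (parent x)) (g (parent x) x))"
  have hW: "h x = u x" if "x \<in> ?W" for x using that by (simp add: h_def)
  have hB: "h y = Pendant (u x) (g x y)" if "y \<in> leaf_nbrs T x" for x y
    using WB[OF that] parent[OF that] by (simp add: h_def)
  have u_inj: "x = x'" if "u x = u x'" "x \<in> ?W" "x' \<in> ?W" for x x'
    using that bij_betw_imp_inj_on[OF n] by (auto simp: u_def inj_on_def split: if_splits)
  have g_inj: "y = y'" if "g x y = g x y'" "y \<in> leaf_nbrs T x" "y' \<in> leaf_nbrs T x" for x y y'
    using that bij_betw_imp_inj_on[OF g[of x]] by (auto dest: inj_onD)
  have u_Pendant: "u x \<noteq> Pendant w i" for x w i by (simp add: u_def)
  have inj: "inj_on h (pverts T)"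
  proof (rule inj_onI)
    fix y y' assume y: "y \<in> pverts T" "y' \<in> pverts T" and eq: "h y = h y'"
    \<comment> \<open>The constructor \<open>Pendant\<close> separates leaves from interior
      vertices; for two leaves it yields first equal parents, then equal indices.\<close>
    consider "y \<in> ?W" | x where "x \<in> ?W" "y \<in> leaf_nbrs T x" using y(1) vertsT by blast
    then show "y = y'"
    proof cases
      case 1
      then have "y' \<in> ?W"
        using y(2) eq vertsT hW[OF 1] hB u_Pendant by fastforce
      then show ?thesis using u_inj hW 1 eq by metis
    next
      case (2 x)
      then have "y' \<notin> ?W"
        using eq hW[of y'] hB[OF 2(2)] u_Pendant by metis
      then obtain x' where x': "x' \<in> ?W" "y' \<in> leaf_nbrs T x'" using y(2) vertsT by blast
      have "Pendant (u x) (g x y) = Pendant (u x') (g x' y')"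
        using eq hB[OF 2(2)] hB[OF x'(2)] by simp
      then have "u x = u x'" "g x y = g x' y'" by simp_all
      then show ?thesis using u_inj[of x x'] g_inj 2 x' by metis
    qed
  qed
  have h_arms: "h ` (?W - {v}) = Lft ` {1..k - 1}"
  proof -
    have "h ` (?W - {v}) = Lft ` n ` (?W - {v})"
      unfolding image_image by (intro image_cong) (auto simp: hW u_def)
    then show ?thesis using bij_betw_imp_surj_on[OF n] by simp
  qed
  have h_v: "h v = Spine 0" using v by (simp add: hW u_def)
  have h_leaves: "h ` leaf_nbrs T x = Pendant (h x) ` {1..card (leaf_nbrs T x)}" if "x \<in> ?W" for x
  proof -
    have "h ` leaf_nbrs T x = Pendant (h x) ` g x ` leaf_nbrs T x"
      unfolding image_image using that by (intro image_cong) (auto simp: hW hB)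
    then show ?thesis using bij_betw_imp_surj_on[OF g[of x]] by simp
  qed
  have W: "?W = insert v (?W - {v})" using v by blast
  \<comment> \<open>A general \<open>F\<close> serves both uses: forgetting its first argument gives
    the vertices, the rectangle of both gives the arcs.\<close>
  have leaf_images: "(\<Union>x\<in>?W. F (h x) (h ` leaf_nbrs T x))
      = F (Spine 0) (Pendant (Spine 0) ` {1..a + 1})
        \<union> (\<Union>w\<in>Lft ` {1..k - 1}. F w (Pendant w ` {1..a}))"
    for F :: "slp_vertex \<Rightarrow> slp_vertex set \<Rightarrow> 'b set"
  proof -
    have "(\<Union>x\<in>?W. F (h x) (h ` leaf_nbrs T x))
        = F (h v) (h ` leaf_nbrs T v) \<union> (\<Union>x\<in>?W - {v}. F (h x) (h ` leaf_nbrs T x))"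
      by (subst W) blast
    also have "(\<Union>x\<in>?W - {v}. F (h x) (h ` leaf_nbrs T x))
        = (\<Union>x\<in>?W - {v}. F (h x) (Pendant (h x) ` {1..a}))"
      using star h_leaves by (intro SUP_cong) auto
    also have "\<dots> = (\<Union>w\<in>h ` (?W - {v}). F w (Pendant w ` {1..a}))" by simp
    finally show ?thesis using h_leaves[OF v] by (simp add: h_v h_arms lv)
  qed
  have verts: "pverts (SLP (a + 1) a 0 (k - 1) 0) = h ` pverts T"
  proof -
    have "h ` pverts T = insert (h v) (h ` (?W - {v})) \<union> (\<Union>x\<in>?W. h ` leaf_nbrs T x)"
      unfolding vertsT image_Un image_UN using v by blast
    then show ?thesis
      using leaf_images[of "\<lambda>_ X. X"] by (simp add: pverts_SLP_star h_v h_arms Un_assoc)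
  qed
  have "map_prod h h ` E = {h v} \<times> h ` (?W - {v}) \<union> (\<Union>x\<in>?W. {h x} \<times> h ` leaf_nbrs T x)"
    unfolding E_def image_Un image_UN map_prod_surj_on[OF refl refl] by simp
  also have "\<dots> = slp_arcs (a + 1) a 0 (k - 1) 0"
    using leaf_images[of "\<lambda>x X. {x} \<times> X"] by (simp add: slp_arcs_star h_v h_arms Un_assoc)
  finally have E: "map_prod h h ` E = slp_arcs (a + 1) a 0 (k - 1) 0" .
  have "map_prod h h ` E\<inverse> = (map_prod h h ` E)\<inverse>" by force
  then have "parcs (SLP (a + 1) a 0 (k - 1) 0) = map_prod h h ` parcs T"
    by (simp add: parcs_SLP arcsT image_Un E)
  then show ?thesis
    unfolding digraph_iso_with_proj_iff[OF pair_wf_digraph_axioms] using inj verts by blast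
qed

section \<open>The bound and its equality case\<close>

theorem theorem3p6:
  fixes a k b :: nat and T :: "'a pair_pre_digraph"
  assumes "a \<ge> 1" and "k \<ge> 2" and "b = a * k + 1"
    and "simple_tree T"
    and "card (interior_verts T) = k"
    and "card (boundary_verts T) = b"
  shows "first_dirichlet_eigenvalue T
           \<le> (real k + 2 * real a + 1 - sqrt ((real k - 1)^2 + 4 * real k - 4)) / 2
       \<and> (first_dirichlet_eigenvalue T
             = (real k + 2 * real a + 1 - sqrt ((real k - 1)^2 + 4 * real k - 4)) / 2
          \<longleftrightarrow> digraph_iso (with_proj T) (with_proj (SLP (a + 1) a 0 (k - 1) 0)))"
proof -
  define s where "s = sqrt ((real k - 1)^2 + 4 * real k - 4)"
  \<comment> \<open>The smaller root of x^2 - (k + 1) x + 1, whose discriminant (k + 1)^2 - 4 is the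
    radicand of s.\<close>
  define m where "m = (real k + 1 - s) / 2"
  have T: "pair_graph T" using assms(4) by (simp add: simple_tree_def)
  then interpret pair_graph T .
  have b: "card (boundary_verts T) = a * k + 1" and k: "k \<ge> 1" using assms by auto
  have s2: "s\<^sup>2 = (real k + 1)\<^sup>2 - 4"
  proof -
    have "0 \<le> (real k - 1)^2 + 4 * real k - 4"
      using \<open>k \<ge> 2\<close> zero_le_power2[of "real k - 1"] by linarith
    then show ?thesis
      by (simp add: s_def power2_eq_square algebra_simps)
  qed
  have "s < real k + 1"
    using s2 by (intro power2_less_imp_less[of s]) auto
  then have m0: "0 < m" by (simp add: m_def)
  \<comment> \<open>Here k > 1 enters: the radicand exceeds (k - 1)^2 by 4 k - 4 > 0.\<close>
  have "real k - 1 < s"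
    unfolding s_def using \<open>k \<ge> 2\<close> by (intro real_less_rsqrt) simp
  then have m1: "m < 1" by (simp add: m_def)
  have root: "m\<^sup>2 - (real k + 1) * m + 1 = 0"
    using s2 by (simp add: m_def power2_eq_square field_simps)
  have bound: "(real k + 2 * real a + 1 - sqrt ((real k - 1)^2 + 4 * real k - 4)) / 2 = real a + m"
    by (simp add: m_def s_def field_simps)
  note upper = first_dirichlet_eigenvalue_le[OF T assms(5) k b m0 m1 root]
  have ne: "interior_verts T \<noteq> {}" using assms(5) k by auto
  have "digraph_iso (with_proj T) (with_proj (SLP (a + 1) a 0 (k - 1) 0))"
    if l: "first_dirichlet_eigenvalue T = real a + m"
  proof -
    obtain v where "v \<in> interior_verts T" "card (leaf_nbrs T v) = a + 1"
        "\<And>x. x \<in> interior_verts T - {v} \<Longrightarrow> x \<in> nbrs T v \<and> card (leaf_nbrs T x) = a"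
      using upper(2)[OF l] by blast
    then show ?thesis by (rule digraph_iso_SLP_star[OF assms(4,5) b])
  qed
  \<comment> \<open>The first eigenvalue of T is also an eigenvalue of the star-like tree, hence at
    least a + m; the upper bound gives equality.\<close>
  moreover have "first_dirichlet_eigenvalue T = real a + m"
    if "digraph_iso (with_proj T) (with_proj (SLP (a + 1) a 0 (k - 1) 0))"
    using SLP_star_eigenvalue_ge[OF assms(1,2) m1 root
        dirichlet_eigenvalue_iso[OF pair_wf_digraph_axioms that dirichlet_eigenvalue_first[OF T ne]]]
      upper(1) by simp
  ultimately show ?thesis unfolding bound using upper(1) by blast
qed

end
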